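(* For every complex number $q$ with $0<|q|<1$, $$\sum_{n=0}^\infty \sum_{|m|\leq n}(-1)^{m}q^{m^2+n^2}(1+q^{2n+1}) = g_{1,0,1}(q^2,q^2;q^4)+q\,g_{1,0,1}(q^4,q^4;q^4),$$ and $$\sum_{n=0}^\infty \sum_{|m|\leq n}(-1)^{m}q^{m^2+n^2}(1-q^{2n+1}) = f_{1,0,1}(q^2,q^2;q^4)+q\,f_{1,0,1}(q^4,q^4;q^4)=j(q^2;q^4).$$
   Context: Notation: $(x;q)_\infty:=\prod_{i=0}^{\infty}(1-q^ix)$ and $j(x;q):=(x;q)_\infty(q/x;q)_\infty(q;q)_\infty=\sum_{n\in\mathbb{Z}}(-1)^nq^{\binom n2}x^n$ for $x\neq0$. Type I and type II double-sums: $$f_{a,b,c}(x,y;q):=\Big(\sum_{r,s\ge 0}-\sum_{r,s<0}\Big)(-1)^{r+s}x^ry^sq^{a\binom r2+brs+c\binom s2},$$ $$g_{a,b,c}(x,y;q):=\Big(\sum_{r,s\ge 0}+\sum_{r,s<0}\Big)(-1)^{r+s}x^ry^sq^{a\binom r2+brs+c\binom s2},$$ where $r,s$ run over integers, the first sum is over pairs with both $r,s\ge0$ and the second over pairs with both $r,s<0$, and $\binom{r}{2}=r(r-1)/2$ for all integers $r$. *)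

theory Defs
  imports "HOL-Analysis.Analysis"
begin

definition qpoch_inf :: "complex \<Rightarrow> complex \<Rightarrow> complex" where
  "qpoch_inf x q = (\<Prod>i. 1 - q ^ i * x)"

definition jtheta :: "complex \<Rightarrow> complex \<Rightarrow> complex" where
  "jtheta x q = qpoch_inf x q * qpoch_inf (q / x) q * qpoch_inf q q"

text \<open>
  Since \<open>r * (r - 1)\<close> is even for every integer \<open>r\<close>, the \<open>div\<close> is exact, also for
  negative \<open>r\<close>.
\<close>

definition binom2 :: "int \<Rightarrow> int" where
  "binom2 r = r * (r - 1) div 2"

definition double_sum_term ::
    "int \<Rightarrow> int \<Rightarrow> int \<Rightarrow> complex \<Rightarrow> complex \<Rightarrow> complex \<Rightarrow> int \<times> int \<Rightarrow> complex" where
  "double_sum_term a b c x y q = (\<lambda>(r, s).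
     (-1) powi (r + s) * x powi r * y powi s * q powi (a * binom2 r + b * r * s + c * binom2 s))"

text \<open>
  The unordered sums below are meaningful only where both families are (absolutely)
  summable; this is the case for \<open>a = c = 1\<close>, \<open>b = 0\<close>, \<open>0 < norm q < 1\<close> and
  \<open>x\<close>, \<open>y\<close> nonzero.
\<close>

definition f_double_sum ::
    "int \<Rightarrow> int \<Rightarrow> int \<Rightarrow> complex \<Rightarrow> complex \<Rightarrow> complex \<Rightarrow> complex" where
  "f_double_sum a b c x y q =
     (\<Sum>\<^sub>\<infinity>p\<in>{0..} \<times> {0..}. double_sum_term a b c x y q p)
     - (\<Sum>\<^sub>\<infinity>p\<in>{..<0} \<times> {..<0}. double_sum_term a b c x y q p)"

definition g_double_sum ::
    "int \<Rightarrow> int \<Rightarrow> int \<Rightarrow> complex \<Rightarrow> complex \<Rightarrow> complex \<Rightarrow> complex" where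
  "g_double_sum a b c x y q =
     (\<Sum>\<^sub>\<infinity>p\<in>{0..} \<times> {0..}. double_sum_term a b c x y q p)
     + (\<Sum>\<^sub>\<infinity>p\<in>{..<0} \<times> {..<0}. double_sum_term a b c x y q p)"

end

theory Submission
  imports Defs
begin

text \<open>
  The inner sum runs over \<open>h(n, m) + h(n + 1, m)\<close> or \<open>h(n, m) - h(n + 1, m)\<close>, where
  \<open>h(n, m)\<close> has exponent \<open>m^2 + n^2\<close> and sign \<open>(-1)^m\<close>.  Since
  \<open>2 r^2 + 2 s^2 = (r + s)^2 + (r - s)^2\<close>, the two quadrants of each double sum are carried by
  \<open>(r, s) \<mapsto> (r + s, r - s)\<close>, up to a shift and a reflection, onto the points of even or
  odd parity in the cone \<open>\<bar>m\<bar> \<le> n\<close>, which gives both expansions.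

  In \<open>f(q^4, q^4; q^4)\<close> the quadrants cancel.  In \<open>f(q^2, q^2; q^4)\<close> the sums factor, so that
  it equals the theta series with exponents \<open>2 j^2\<close>.  The product formula for that series is
  the limit, by Tannery's theorem, of Cauchy's finite form of the triple product at \<open>z = -1\<close>.
\<close>

section \<open>Even functions on the integers\<close>

text \<open>Reflection matches the negative integers with the positive ones, and doubling the series
  counts 0 twice. This trades sums over the integers for series over the naturals, the setting of
  Tannery's theorem.\<close>

lemma infsum_int_even:
  fixes f :: "int \<Rightarrow> complex"
  assumes summable: "f summable_on UNIV" and even: "\<And>j. f (- j) = f j"
  shows "infsum f UNIV = 2 * (\<Sum>n. f (int n)) - f 0"
proof -
  have nonneg: "infsum f {0..} = (\<Sum>n. f (int n))"
  proof -
    have bij: "bij_betw int UNIV {0..}"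
      by (rule bij_betwI[of _ _ _ nat]) auto
    have "f summable_on {0..}"
      using summable by (rule summable_on_subset_banach) auto
    then have "((\<lambda>n. f (int n)) has_sum infsum f {0..}) UNIV"
      using has_sum_reindex_bij_betw[OF bij, of f] by auto
    then show ?thesis
      using has_sum_imp_sums sums_unique by metis
  qed
  have sub: "f summable_on A" for A
    using summable by (rule summable_on_subset_banach) auto
  have split: "infsum f {0..} = f 0 + infsum f {0<..}"
  proof -
    have "{0::int..} = {0} \<union> {0<..}" by auto
    then show ?thesis
      using infsum_Un_disjoint[of f "{0}" "{0<..}"] sub by simp
  qed
  have "bij_betw uminus {0<..} {..<0::int}"
    by (rule bij_betwI[of _ _ _ uminus]) auto
  then have neg: "infsum f {..<0} = infsum f {0<..}"
    using infsum_reindex_bij_betw[of uminus "{0<..}" "{..<0}" f] even by simp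
  have "UNIV = {0::int..} \<union> {..<0}" by auto
  then have "infsum f UNIV = infsum f {0..} + infsum f {..<0}"
    using infsum_Un_disjoint[of f "{0..}" "{..<0}"] sub by force
  then show ?thesis
    using nonneg split neg by (simp add: algebra_simps)
qed

section \<open>Infinite q-products and reciprocals of finite ones\<close>

lemma qpoch_inf_LIMSEQ:
  assumes "norm q < 1"
  shows "(\<lambda>n. \<Prod>i<n. 1 - q ^ i * x) \<longlonglongrightarrow> qpoch_inf x q"
    and convergent_qpoch: "convergent_prod (\<lambda>i. 1 - q ^ i * x)"
proof -
  have "summable (\<lambda>i. norm (q ^ i * x))"
    using assms by (auto simp: norm_mult norm_power intro!: summable_mult2 summable_geometric)
  then show conv: "convergent_prod (\<lambda>i. 1 - q ^ i * x)"
    by (intro abs_convergent_prod_imp_convergent_prod summable_imp_abs_convergent_prod) simp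
  have "(\<lambda>n. \<Prod>i<Suc n. 1 - q ^ i * x) \<longlonglongrightarrow> qpoch_inf x q"
    using convergent_prod_LIMSEQ[OF conv] by (simp add: qpoch_inf_def lessThan_Suc_atMost)
  then show "(\<lambda>n. \<Prod>i<n. 1 - q ^ i * x) \<longlonglongrightarrow> qpoch_inf x q"
    by (rule LIMSEQ_imp_Suc)
qed

lemma one_minus_power_nonzero:
  fixes q :: "'a::real_normed_div_algebra"
  assumes "norm q < 1"
  shows "1 - q ^ Suc i \<noteq> 0"
proof
  assume "1 - q ^ Suc i = 0"
  then have "norm q ^ Suc i = 1"
    by (metis norm_one norm_power right_minus_eq)
  moreover have "norm q ^ Suc i < 1"
    using assms by (simp add: power_less_one_iff del: power_Suc)
  ultimately show False by simp
qed

lemma qpoch_inf_self_nonzero: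
  assumes "norm q < 1"
  shows "qpoch_inf q q \<noteq> 0"
  unfolding qpoch_inf_def
  by (rule prodinf_nonzero[OF convergent_qpoch[OF assms]])
     (use one_minus_power_nonzero[OF assms] in \<open>simp add: mult.commute\<close>)

text \<open>The value \<open>0\<close> at negative arguments makes the recurrence below hold for all
  integers, so that the finite sums become sums over all of \<open>\<int>\<close> without boundary terms.\<close>

definition qfact_recip :: "complex \<Rightarrow> int \<Rightarrow> complex" where
  "qfact_recip q k = (if k < 0 then 0 else inverse (\<Prod>i<nat k. 1 - q ^ Suc i))"

lemma qfact_recip_pred:
  assumes "norm q < 1"
  shows "qfact_recip q (k - 1) = (1 - q powi k) * qfact_recip q k"
proof (cases "k \<le> 0")
  case True
  then show ?thesis by (cases "k = 0") (auto simp: qfact_recip_def)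
next
  case False
  define n where "n = nat (k - 1)"
  have k: "k = int (Suc n)" using False by (simp add: n_def)
  have powi: "q powi k = q ^ Suc n"
    unfolding k by (rule power_int_of_nat)
  have "nat k = Suc n" "nat (k - 1) = n" using k by auto
  moreover have "\<not> k < 0" "\<not> k - 1 < 0" using False by auto
  ultimately show ?thesis
    unfolding qfact_recip_def powi using one_minus_power_nonzero[OF assms, of n] by simp
qed

lemma qfact_recip_LIMSEQ:
  assumes "norm q < 1"
  shows "(\<lambda>n. qfact_recip q (int n)) \<longlonglongrightarrow> inverse (qpoch_inf q q)"
  using tendsto_inverse[OF qpoch_inf_LIMSEQ(1)[OF assms, of q] qpoch_inf_self_nonzero[OF assms]]
  by (simp add: qfact_recip_def mult.commute)

text \<open>A convergent sequence is bounded. One bound for all \<open>k\<close> yields a majorant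
  of \<open>cauchy_term\<close> that does not depend on \<open>n\<close>.\<close>

lemma qfact_recip_bounded:
  assumes "norm q < 1"
  obtains M where "\<And>k. norm (qfact_recip q k) \<le> M"
proof -
  have "Bseq (\<lambda>n. qfact_recip q (int n))"
    using qfact_recip_LIMSEQ[OF assms] by (intro convergent_imp_Bseq) (auto simp: convergent_def)
  then obtain M where M: "M > 0" "\<And>n. norm (qfact_recip q (int n)) \<le> M"
    by (auto simp: Bseq_def)
  have "norm (qfact_recip q k) \<le> M" for k
    using M(1) M(2)[of "nat k"] by (cases "k < 0") (auto simp: qfact_recip_def)
  then show ?thesis using that by blast
qed

section \<open>Cauchy's finite form of the triple product\<close>

text \<open>For \<open>norm q < 1\<close> this is the j-th summand of Cauchy's formula at z = -1,
  divided by (q^2;q^2)_{2n}: the two reciprocals are the Gaussian binomial [2n, n+j] in base q^2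
  over that product. Outside -n..n one of them has a negative argument, so the term
  vanishes.\<close>

definition cauchy_term :: "complex \<Rightarrow> nat \<Rightarrow> int \<Rightarrow> complex" where
  "cauchy_term q n j = (-1) powi j * q powi (j\<^sup>2)
     * qfact_recip (q\<^sup>2) (int n - j) * qfact_recip (q\<^sup>2) (int n + j)"

lemma cauchy_term_minus: "cauchy_term q n (- j) = cauchy_term q n j"
  by (simp add: cauchy_term_def power_int_minus flip: power_int_inverse)

lemma cauchy_term_summable: "cauchy_term q n summable_on A"
proof -
  have "cauchy_term q n summable_on A \<inter> {- int n..int n}"
    by (rule summable_on_finite) auto
  then show ?thesis
    by (rule summable_on_cong_neutral[THEN iffD1, rotated -1])
       (auto simp: cauchy_term_def qfact_recip_def)
qed

text \<open>Multiplying the finite product by its next factors (1 + z q^(2n+1)) (1 + q^(2n+1) / z)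
  and comparing coefficients gives this recurrence; at z = -1 the neighbours \<open>j - 1\<close>
  and \<open>j + 1\<close> enter with a minus sign. The two factors on the left arise as
  (q^2;q^2)_{2n} advances by two.\<close>

lemma cauchy_term_Suc:
  assumes "q \<noteq> 0" "norm q < 1"
  shows "(1 - (q\<^sup>2) ^ (2 * n + 1)) * (1 - (q\<^sup>2) ^ (2 * n + 2)) * cauchy_term q (Suc n) j
    = (1 + q ^ (4 * n + 2)) * cauchy_term q n j
      - q ^ (2 * n + 1) * (cauchy_term q n (j - 1) + cauchy_term q n (j + 1))"
proof -
  let ?R = "qfact_recip (q\<^sup>2)"
  \<comment> \<open>Each reciprocal below is a polynomial in \<open>a\<close> and \<open>b\<close>
    times a factor of \<open>X\<close>, so all four terms become multiples of
    \<open>e * X\<close>.\<close>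
  define X where "X = ?R (int n + 1 - j) * ?R (int n + 1 + j)"
  define a where "a = (q\<^sup>2) powi (int n - j)"
  define b where "b = (q\<^sup>2) powi (int n + j)"
  define e where "e = (-1::complex) powi j * q powi (j\<^sup>2)"
  have q2: "norm (q\<^sup>2) < 1" "q\<^sup>2 \<noteq> 0"
    using assms by (auto simp: norm_power power_less_one_iff)
  have Suc_a: "(q\<^sup>2) powi (int n + 1 - j) = q\<^sup>2 * a"
    and Suc_b: "(q\<^sup>2) powi (int n + 1 + j) = q\<^sup>2 * b"
    unfolding a_def b_def using q2(2) by (simp_all add: power_int_add power_int_diff)
  have R1: "?R (int n - j) = (1 - q\<^sup>2 * a) * ?R (int n + 1 - j)"
    using qfact_recip_pred[OF q2(1), of "int n + 1 - j"] Suc_a by (simp add: algebra_simps)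
  have R2: "?R (int n + j) = (1 - q\<^sup>2 * b) * ?R (int n + 1 + j)"
    using qfact_recip_pred[OF q2(1), of "int n + 1 + j"] Suc_b by (simp add: algebra_simps)
  have R3: "?R (int n - (j + 1)) = (1 - a) * ?R (int n - j)"
    using qfact_recip_pred[OF q2(1), of "int n - j"] by (simp add: a_def algebra_simps)
  have R4: "?R (int n + (j - 1)) = (1 - b) * ?R (int n + j)"
    using qfact_recip_pred[OF q2(1), of "int n + j"] by (simp add: b_def algebra_simps)
  have R5: "?R (int n - (j - 1)) = ?R (int n + 1 - j)" "?R (int n + (j + 1)) = ?R (int n + 1 + j)"
    by (simp_all add: algebra_simps)
  have c0: "cauchy_term q n j = e * (1 - q\<^sup>2 * a) * (1 - q\<^sup>2 * b) * X"
    unfolding cauchy_term_def R1 R2 X_def e_def by simp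
  have cS: "cauchy_term q (Suc n) j = e * X"
    unfolding cauchy_term_def X_def e_def by (simp add: algebra_simps)
  have split: "q powi (2 + 2 * x + j\<^sup>2) = q\<^sup>2 * (q\<^sup>2) powi x * q powi (j\<^sup>2)" for x
    using assms(1) by (simp add: power_int_add power_int_mult)
  \<comment> \<open>The weight \<open>q ^ (2 * n + 1)\<close> is what makes the shifted square
    differ from \<open>j\<^sup>2\<close> by an even exponent, that is, by a power of
    \<open>q\<^sup>2\<close>.\<close>
  have e1: "q ^ (2 * n + 1) * q powi ((j + 1)\<^sup>2) = q\<^sup>2 * b * q powi (j\<^sup>2)"
  proof -
    have "q ^ (2 * n + 1) * q powi ((j + 1)\<^sup>2) = q powi (int (2 * n + 1) + (j + 1)\<^sup>2)"
      using assms(1) by (subst power_int_add) (auto simp only: power_int_of_nat)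
    also have "int (2 * n + 1) + (j + 1)\<^sup>2 = 2 + 2 * (int n + j) + j\<^sup>2"
      by (simp add: power2_eq_square algebra_simps)
    also have "q powi \<dots> = q\<^sup>2 * b * q powi (j\<^sup>2)"
      unfolding b_def by (rule split)
    finally show ?thesis .
  qed
  have e2: "q ^ (2 * n + 1) * q powi ((j - 1)\<^sup>2) = q\<^sup>2 * a * q powi (j\<^sup>2)"
  proof -
    have "q ^ (2 * n + 1) * q powi ((j - 1)\<^sup>2) = q powi (int (2 * n + 1) + (j - 1)\<^sup>2)"
      using assms(1) by (subst power_int_add) (auto simp only: power_int_of_nat)
    also have "int (2 * n + 1) + (j - 1)\<^sup>2 = 2 + 2 * (int n - j) + j\<^sup>2"
      by (simp add: power2_eq_square algebra_simps)
    also have "q powi \<dots> = q\<^sup>2 * a * q powi (j\<^sup>2)"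
      unfolding a_def by (rule split)
    finally show ?thesis .
  qed
  have sgn: "(-1::complex) powi (j + 1) = - ((-1) powi j)" "(-1::complex) powi (j - 1) = - ((-1) powi j)"
    by (simp_all add: power_int_add power_int_diff)
  have "cauchy_term q n (j + 1)
      = q powi ((j + 1)\<^sup>2) * (- ((-1) powi j) * ((1 - a) * (1 - q\<^sup>2 * a) * X))"
    unfolding cauchy_term_def R3 R1 R5 sgn X_def by (simp only: mult_ac)
  then have "q ^ (2 * n + 1) * cauchy_term q n (j + 1)
      = q\<^sup>2 * b * q powi (j\<^sup>2) * (- ((-1) powi j) * ((1 - a) * (1 - q\<^sup>2 * a) * X))"
    by (simp only: e1 mult.assoc[symmetric])
  then have c1: "q ^ (2 * n + 1) * cauchy_term q n (j + 1) = - (q\<^sup>2 * b * e * (1 - a) * (1 - q\<^sup>2 * a) * X)"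
    unfolding e_def by simp
  have "cauchy_term q n (j - 1)
      = q powi ((j - 1)\<^sup>2) * (- ((-1) powi j) * ((1 - b) * (1 - q\<^sup>2 * b) * X))"
    unfolding cauchy_term_def R4 R2 R5 sgn X_def by (simp only: mult_ac)
  then have "q ^ (2 * n + 1) * cauchy_term q n (j - 1)
      = q\<^sup>2 * a * q powi (j\<^sup>2) * (- ((-1) powi j) * ((1 - b) * (1 - q\<^sup>2 * b) * X))"
    by (simp only: e2 mult.assoc[symmetric])
  then have c2: "q ^ (2 * n + 1) * cauchy_term q n (j - 1) = - (q\<^sup>2 * a * e * (1 - b) * (1 - q\<^sup>2 * b) * X)"
    unfolding e_def by simp
  \<comment> \<open>The product is free of \<open>j\<close>. It expresses the remaining powers of
    \<open>q\<close> through \<open>a\<close> and \<open>b\<close>, which leaves a polynomial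
    identity.\<close>
  have ab: "a * b = (q\<^sup>2) ^ (2 * n)"
  proof -
    have "a * b = (q\<^sup>2) powi (int (2 * n))"
      unfolding a_def b_def using q2(2) by (simp flip: power_int_add)
    then show ?thesis by (simp only: power_int_of_nat)
  qed
  have p1: "(q\<^sup>2) ^ (2 * n + 1) = q\<^sup>2 * (a * b)" "(q\<^sup>2) ^ (2 * n + 2) = q\<^sup>2 * q\<^sup>2 * (a * b)"
    unfolding ab by (simp_all add: mult.assoc)
  have p2: "q ^ (4 * n + 2) = q\<^sup>2 * (a * b)"
    unfolding ab by (simp only: power_mult[symmetric] power_add[symmetric]) simp
  show ?thesis
    unfolding distrib_left c0 cS c1 c2 p1 p2 by algebra
qed

text \<open>Summed over all \<open>j\<close>, the recurrence sees three translates with the same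
  sum, so each step contributes 1 + q^(4n+2) - 2 q^(2n+1) = (1 - q^(2n+1))^2.\<close>

lemma cauchy_sum:
  assumes "q \<noteq> 0" "norm q < 1"
  shows "(\<Prod>i<2 * n. 1 - (q\<^sup>2) ^ Suc i) * infsum (cauchy_term q n) UNIV
    = (\<Prod>i<n. (1 - q ^ (2 * i + 1))\<^sup>2)"
proof (induction n)
  case 0
  have "infsum (cauchy_term q 0) UNIV = infsum (cauchy_term q 0) {0}"
    by (rule infsum_cong_neutral) (auto simp: cauchy_term_def qfact_recip_def)
  also have "\<dots> = 1"
    by (simp add: cauchy_term_def qfact_recip_def)
  finally show ?case by simp
next
  case (Suc n)
  define T where "T n = infsum (cauchy_term q n) UNIV" for n
  have shift: "((\<lambda>j. cauchy_term q n (j + k)) has_sum T n) UNIV" for k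
  proof -
    have "bij_betw (\<lambda>j. j + k) UNIV UNIV"
      by (rule bij_betwI[of _ _ _ "\<lambda>j. j - k"]) auto
    then show ?thesis
      unfolding T_def
      using has_sum_reindex_bij_betw[of "\<lambda>j. j + k" UNIV UNIV "cauchy_term q n"]
        cauchy_term_summable by auto
  qed
  have "((\<lambda>j. (1 + q ^ (4 * n + 2)) * cauchy_term q n j
      + - (q ^ (2 * n + 1)) * (cauchy_term q n (j - 1) + cauchy_term q n (j + 1)))
    has_sum (1 + q ^ (4 * n + 2)) * T n + - (q ^ (2 * n + 1)) * (T n + T n)) UNIV"
    using shift[of 0] shift[of 1] shift[of "- 1"]
    by (intro has_sum_add has_sum_cmult_right) auto
  moreover have "((\<lambda>j. (1 - (q\<^sup>2) ^ (2 * n + 1)) * (1 - (q\<^sup>2) ^ (2 * n + 2)) * cauchy_term q (Suc n) j)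
    has_sum (1 - (q\<^sup>2) ^ (2 * n + 1)) * (1 - (q\<^sup>2) ^ (2 * n + 2)) * T (Suc n)) UNIV"
    unfolding T_def using cauchy_term_summable by (intro has_sum_cmult_right) auto
  ultimately have "(1 - (q\<^sup>2) ^ (2 * n + 1)) * (1 - (q\<^sup>2) ^ (2 * n + 2)) * T (Suc n)
      = (1 + q ^ (4 * n + 2)) * T n - q ^ (2 * n + 1) * (T n + T n)"
    unfolding cauchy_term_Suc[OF assms] by (simp add: has_sum_unique)
  also have "\<dots> = (1 - q ^ (2 * n + 1))\<^sup>2 * T n"
  proof -
    have "q ^ (4 * n + 2) = (q ^ (2 * n + 1))\<^sup>2"
      by (simp only: power_mult[symmetric]) simp
    moreover have "(1 + u\<^sup>2) * t - u * (t + t) = (1 - u)\<^sup>2 * t" for u t :: complex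
      by (simp add: power2_eq_square algebra_simps)
    ultimately show ?thesis by (simp only:)
  qed
  finally have step: "(1 - (q\<^sup>2) ^ (2 * n + 1)) * (1 - (q\<^sup>2) ^ (2 * n + 2)) * T (Suc n)
      = (1 - q ^ (2 * n + 1))\<^sup>2 * T n" .
  have "(\<Prod>i<2 * Suc n. 1 - (q\<^sup>2) ^ Suc i) * T (Suc n)
      = (\<Prod>i<2 * n. 1 - (q\<^sup>2) ^ Suc i)
        * ((1 - (q\<^sup>2) ^ (2 * n + 1)) * (1 - (q\<^sup>2) ^ (2 * n + 2)) * T (Suc n))"
    by (simp add: mult.assoc)
  also have "\<dots> = ((\<Prod>i<2 * n. 1 - (q\<^sup>2) ^ Suc i) * T n) * (1 - q ^ (2 * n + 1))\<^sup>2"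
    unfolding step by (simp only: mult_ac)
  also have "\<dots> = (\<Prod>i<Suc n. (1 - q ^ (2 * i + 1))\<^sup>2)"
    unfolding Suc.IH[folded T_def] by simp
  finally show ?case
    unfolding T_def .
qed

section \<open>The alternating theta series and its product formula\<close>

text \<open>Since |j| \<le> j^2, a geometric majorant is available; it serves both summability and
  the domination in Tannery's theorem.\<close>

lemma norm_powi_square_le:
  fixes q :: "'a::real_normed_div_algebra"
  assumes "norm q \<le> 1"
  shows "norm (q powi (j\<^sup>2)) \<le> norm q ^ nat \<bar>j\<bar>"
proof -
  have "\<bar>j\<bar> \<le> j\<^sup>2"
    by (metis abs_ge_zero abs_le_square_iff int_one_le_iff_zero_less linorder_not_less
        mult_le_cancel_left1 nle_le power2_abs power2_eq_square)
  then have "norm q ^ nat (j\<^sup>2) \<le> norm q ^ nat \<bar>j\<bar>"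
    using assms by (intro power_decreasing) auto
  then show ?thesis
    by (simp add: power_int_def norm_power)
qed

lemma powi_square_abs_summable:
  fixes q :: complex
  assumes "norm q < 1"
  shows "(\<lambda>j. norm (q powi (j\<^sup>2))) summable_on A"
proof -
  have geom: "(\<lambda>n. norm q ^ n) summable_on UNIV"
    using assms by (subst summable_on_UNIV_nonneg_real_iff) auto
  have "bij_betw int UNIV {0..}"
    by (rule bij_betwI[of _ _ _ nat]) auto
  then have 1: "(\<lambda>j. norm q ^ nat \<bar>j\<bar>) summable_on {0..}"
    using summable_on_reindex_bij_betw[of int UNIV "{0..}" "\<lambda>j. norm q ^ nat \<bar>j\<bar>"] geom by simp
  have "bij_betw uminus {0..} {..0::int}"
    by (rule bij_betwI[of _ _ _ uminus]) auto
  then have 2: "(\<lambda>j. norm q ^ nat \<bar>j\<bar>) summable_on {..0}"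
    using summable_on_reindex_bij_betw[of uminus "{0..}" "{..0}" "\<lambda>j::int. norm q ^ nat \<bar>j\<bar>"] 1 by simp
  have "(\<lambda>j. norm q ^ nat \<bar>j\<bar>) summable_on {0..} \<union> {..0}"
    by (rule summable_on_union[OF 1 2])
  then have "(\<lambda>j. norm q ^ nat \<bar>j\<bar>) summable_on A"
    by (rule summable_on_subset_banach) auto
  then show ?thesis
    by (rule Infinite_Sum.abs_summable_on_comparison_test') (use norm_powi_square_le[of q] assms in auto)
qed

lemma alternating_powi_square_summable:
  fixes q :: complex
  assumes "norm q < 1"
  shows "(\<lambda>j. (-1) powi j * q powi (j\<^sup>2)) summable_on A"
  by (rule abs_summable_summable)
     (use powi_square_abs_summable[OF assms] in \<open>simp add: norm_mult norm_power_int\<close>)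

text \<open>As q^2 / q = q, the theta product is (q;q^2)^2 (q^2;q^2), both products infinite. In
  Cauchy's formula the terms tend to \<open>th j\<close> / P^2 and the prefactor tends to P =
  (q^2;q^2), so (q;q^2)^2 is the theta series divided by P.\<close>

theorem jtheta_eq_alternating_sum:
  assumes "q \<noteq> 0" "norm q < 1"
  shows "jtheta q (q\<^sup>2) = (\<Sum>\<^sub>\<infinity>j. (-1) powi j * q powi (j\<^sup>2))"
proof -
  define P where "P = qpoch_inf (q\<^sup>2) (q\<^sup>2)"
  define th where "th j = (-1) powi j * q powi (j\<^sup>2)" for j
  have q2: "norm (q\<^sup>2) < 1"
    using assms by (auto simp: norm_power power_less_one_iff)
  have P0: "P \<noteq> 0"
    unfolding P_def by (rule qpoch_inf_self_nonzero[OF q2])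
  obtain M where M: "\<And>k. norm (qfact_recip (q\<^sup>2) k) \<le> M"
    using qfact_recip_bounded[OF q2] by blast
  have recip_shift: "(\<lambda>n. qfact_recip (q\<^sup>2) (int n + k)) \<longlonglongrightarrow> inverse P" for k
  proof -
    \<comment> \<open>For negative \<open>k\<close> the argument is negative at small
      \<open>n\<close>, where \<open>nat\<close> truncates it to 0; only finitely many
      \<open>n\<close> are affected.\<close>
    have "filterlim (\<lambda>n. nat (int n + k)) at_top sequentially"
      unfolding filterlim_at_top
    proof
      fix Z
      show "\<forall>\<^sub>F n in sequentially. Z \<le> nat (int n + k)"
        by (rule eventually_sequentiallyI[of "Z + nat \<bar>k\<bar>"]) auto
    qed
    then have "(\<lambda>n. qfact_recip (q\<^sup>2) (int (nat (int n + k)))) \<longlonglongrightarrow> inverse P"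
      unfolding P_def using filterlim_compose[OF qfact_recip_LIMSEQ[OF q2]] by blast
    moreover have "\<forall>\<^sub>F n in sequentially. int (nat (int n + k)) = int n + k"
      by (rule eventually_sequentiallyI[of "nat \<bar>k\<bar>"]) auto
    ultimately show ?thesis
      by (auto elim!: Lim_transform_eventually elim: eventually_mono)
  qed
  have term_lim: "(\<lambda>n. cauchy_term q n j) \<longlonglongrightarrow> th j * inverse P * inverse P" for j
    unfolding cauchy_term_def th_def
    using recip_shift[of j] recip_shift[of "- j"] by (intro tendsto_intros) auto
  \<comment> \<open>Nonnegative indices suffice, because evenness folds the sum over the
    integers.\<close>
  have bound: "norm (cauchy_term q n (int k)) \<le> norm q ^ k * M * M" for n k
  proof -
    have "norm (q powi ((int k)\<^sup>2)) \<le> norm q ^ k"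
      using norm_powi_square_le[of q "int k"] assms by simp
    moreover have "M \<ge> 0" using M[of 0] norm_ge_zero order_trans by blast
    ultimately show ?thesis
      unfolding cauchy_term_def norm_mult using M by (intro mult_mono) (auto simp: norm_power_int norm_mult norm_power)
  qed
  have "summable (\<lambda>k. norm q ^ k * M * M)"
    using assms by (intro summable_mult2 summable_geometric) auto
  moreover have "\<forall>\<^sub>F (k, n) in sequentially \<times>\<^sub>F sequentially. norm (cauchy_term q n (int k)) \<le> norm q ^ k * M * M"
    using bound by (auto intro: always_eventually)
  ultimately have "(\<lambda>n. \<Sum>k. cauchy_term q n (int k)) \<longlonglongrightarrow> (\<Sum>k. th (int k) * inverse P * inverse P)"
    using tannerys_theorem[where a = "\<lambda>k n. cauchy_term q n (int k)", OF term_lim] by auto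
  then have "(\<lambda>n. 2 * (\<Sum>k. cauchy_term q n (int k)) - cauchy_term q n 0)
      \<longlonglongrightarrow> 2 * (\<Sum>k. th (int k) * inverse P * inverse P) - th 0 * inverse P * inverse P"
    by (intro tendsto_intros term_lim)
  also have "(\<lambda>n. 2 * (\<Sum>k. cauchy_term q n (int k)) - cauchy_term q n 0)
      = (\<lambda>n. infsum (cauchy_term q n) UNIV)"
    using infsum_int_even[OF cauchy_term_summable cauchy_term_minus] by simp
  also have "2 * (\<Sum>k. th (int k) * inverse P * inverse P) - th 0 * inverse P * inverse P
      = (\<Sum>\<^sub>\<infinity>j. th j * inverse P * inverse P)"
    using alternating_powi_square_summable[OF assms(2), of UNIV]
    by (intro infsum_int_even[symmetric] summable_on_cmult_left)
       (auto simp: th_def power_int_minus simp flip: power_int_inverse)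
  also have "\<dots> = infsum th UNIV * inverse P * inverse P"
    by (simp add: infsum_cmult_left')
  finally have T: "(\<lambda>n. infsum (cauchy_term q n) UNIV) \<longlonglongrightarrow> infsum th UNIV * inverse P * inverse P" .
  \<comment> \<open>The prefactor runs through the partial products of even length.\<close>
  have "(\<lambda>n. \<Prod>i<2 * n. 1 - (q\<^sup>2) ^ i * q\<^sup>2) \<longlonglongrightarrow> P"
    using filterlim_compose[OF qpoch_inf_LIMSEQ(1)[OF q2] mult_nat_left_at_top[of 2]]
    by (simp add: P_def)
  from tendsto_mult[OF this T]
  have "(\<lambda>n. \<Prod>i<n. (1 - q ^ (2 * i + 1))\<^sup>2) \<longlonglongrightarrow> P * (infsum th UNIV * inverse P * inverse P)"
    by (simp only: cauchy_sum[OF assms, symmetric] power_Suc2)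
  also have "P * (infsum th UNIV * inverse P * inverse P) = infsum th UNIV * inverse P"
    using P0 by simp
  finally have "(\<lambda>n. \<Prod>i<n. (1 - q ^ (2 * i + 1))\<^sup>2) \<longlonglongrightarrow> infsum th UNIV * inverse P" .
  moreover have "(\<lambda>n. (\<Prod>i<n. 1 - (q\<^sup>2) ^ i * q)\<^sup>2) \<longlonglongrightarrow> (qpoch_inf q (q\<^sup>2))\<^sup>2"
    by (intro tendsto_power qpoch_inf_LIMSEQ q2)
  ultimately have "(qpoch_inf q (q\<^sup>2))\<^sup>2 = infsum th UNIV * inverse P"
    by (intro LIMSEQ_unique) (simp_all add: prod_power_distrib power_mult mult.commute[of q])
  moreover have "q\<^sup>2 / q = q" by (simp add: power2_eq_square)
  ultimately show ?thesis
    using P0 by (simp add: jtheta_def power2_eq_square[of "qpoch_inf _ _"]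
        P_def[symmetric] th_def[abs_def, symmetric] field_simps)
qed

section \<open>Double sums in rotated coordinates\<close>

lemma binom2_double: "2 * binom2 r = r * (r - 1)"
  by (simp add: binom2_def)

text \<open>Four times \<open>binom2 r\<close> is 2 r^2 - 2 r, so \<open>k = 2\<close> leaves a pure
  square and \<open>k = 4\<close> an additional 2 r.\<close>

lemma powi_binom2:
  fixes q :: complex
  assumes "q \<noteq> 0"
  shows "(q ^ k) powi r * (q ^ 4) powi (binom2 r) = q powi (2 * r\<^sup>2 + (int k - 2) * r)"
proof -
  have "(q ^ k) powi r * (q ^ 4) powi (binom2 r) = q powi (int k * r + 4 * binom2 r)"
    using assms by (simp add: power_int_add power_int_mult)
  also have "int k * r + 4 * binom2 r = 2 * r\<^sup>2 + (int k - 2) * r"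
    using binom2_double[of r] by (simp add: power2_eq_square algebra_simps)
  finally show ?thesis .
qed

lemma double_sum_term_b0:
  fixes q :: complex
  assumes "q \<noteq> 0"
  shows "double_sum_term 1 0 1 (q ^ k) (q ^ k) (q ^ 4) (r, s)
    = (-1) powi (r + s) * q powi (2 * r\<^sup>2 + 2 * s\<^sup>2 + (int k - 2) * (r + s))"
proof -
  have "double_sum_term 1 0 1 (q ^ k) (q ^ k) (q ^ 4) (r, s)
    = (-1) powi (r + s) * ((q ^ k) powi r * (q ^ 4) powi (binom2 r)) * ((q ^ k) powi s * (q ^ 4) powi (binom2 s))"
    using assms by (simp add: double_sum_term_def power_int_add)
  also have "\<dots> = (-1) powi (r + s) * q powi ((2 * r\<^sup>2 + (int k - 2) * r) + (2 * s\<^sup>2 + (int k - 2) * s))"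
    unfolding powi_binom2[OF assms] using assms by (simp add: power_int_add)
  also have "(2 * r\<^sup>2 + (int k - 2) * r) + (2 * s\<^sup>2 + (int k - 2) * s)
      = 2 * r\<^sup>2 + 2 * s\<^sup>2 + (int k - 2) * (r + s)"
    by (simp add: algebra_simps)
  finally show ?thesis .
qed

definition cone_term :: "complex \<Rightarrow> int \<Rightarrow> int \<Rightarrow> complex" where
  "cone_term q n m = (-1) powi m * q powi (m\<^sup>2 + n\<^sup>2)"

lemma cone_term_minus: "cone_term q (- n) m = cone_term q n m"
  and cone_term_minus': "cone_term q n (- m) = cone_term q n m"
  by (simp_all add: cone_term_def power_int_minus flip: power_int_inverse)

lemma neg_one_powi_diff: "(-1 :: complex) powi (r - s) = (-1) powi (r + s)"
proof -
  have "even (r - s) \<longleftrightarrow> even (r + s)" by presburger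
  then show ?thesis by (simp add: power_int_minus_left)
qed

text \<open>Raising the first coordinate to \<open>r + s + 1\<close> adds 2 (r + s) + 1 to the
  exponent: the linear part comes from \<open>k = 4\<close>, and the 1 is the factor
  \<open>q\<close> in front of the double sum.\<close>

lemma double_sum_term_eq_cone_term:
  assumes "q \<noteq> 0"
  shows "double_sum_term 1 0 1 (q\<^sup>2) (q\<^sup>2) (q ^ 4) (r, s) = cone_term q (r + s) (r - s)"
    and "q * double_sum_term 1 0 1 (q ^ 4) (q ^ 4) (q ^ 4) (r, s) = cone_term q (r + s + 1) (r - s)"
proof -
  have "(r - s)\<^sup>2 + (r + s)\<^sup>2 = 2 * r\<^sup>2 + 2 * s\<^sup>2"
    by (simp add: power2_eq_square algebra_simps)
  then show "double_sum_term 1 0 1 (q\<^sup>2) (q\<^sup>2) (q ^ 4) (r, s) = cone_term q (r + s) (r - s)"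
    using double_sum_term_b0[OF assms, of 2] by (simp add: cone_term_def neg_one_powi_diff)
  have "(r - s)\<^sup>2 + (r + s + 1)\<^sup>2 = (2 * r\<^sup>2 + 2 * s\<^sup>2 + 2 * (r + s)) + 1"
    by (simp add: power2_eq_square algebra_simps)
  then have "q powi ((r - s)\<^sup>2 + (r + s + 1)\<^sup>2) = q * q powi (2 * r\<^sup>2 + 2 * s\<^sup>2 + 2 * (r + s))"
    using assms by (simp only: power_int_add_1' simp_thms)
  then show "q * double_sum_term 1 0 1 (q ^ 4) (q ^ 4) (q ^ 4) (r, s) = cone_term q (r + s + 1) (r - s)"
    using double_sum_term_b0[OF assms, of 4] by (simp add: cone_term_def neg_one_powi_diff)
qed

lemma summable_on_times:
  fixes f g :: "_ \<Rightarrow> complex"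
  assumes "(\<lambda>x. norm (f x)) summable_on A" "(\<lambda>y. norm (g y)) summable_on B"
  shows "(\<lambda>(x, y). f x * g y) summable_on A \<times> B"
proof (rule abs_summable_summable, subst Infinite_Sum.abs_summable_on_Sigma_iff, intro conjI ballI)
  show "(\<lambda>y. norm (case (x, y) of (x, y) \<Rightarrow> f x * g y)) summable_on B" for x
    using assms(2) by (auto simp: norm_mult intro: summable_on_cmult_right)
  have "(\<lambda>x. norm (f x) * infsum (\<lambda>y. norm (g y)) B) summable_on A"
    using assms(1) by (rule summable_on_cmult_left)
  then show "(\<lambda>x. norm (\<Sum>\<^sub>\<infinity>y\<in>B. norm (case (x, y) of (x, y) \<Rightarrow> f x * g y))) summable_on A"
    by (simp add: norm_mult infsum_cmult_right' infsum_nonneg)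
qed

lemma infsum_times:
  fixes f g :: "_ \<Rightarrow> complex"
  assumes "(\<lambda>x. norm (f x)) summable_on A" "(\<lambda>y. norm (g y)) summable_on B"
  shows "(\<Sum>\<^sub>\<infinity>(x, y)\<in>A \<times> B. f x * g y) = infsum f A * infsum g B"
  using infsum_Sigma_banach[OF summable_on_times[OF assms]]
  by (simp add: infsum_cmult_right' infsum_cmult_left')

text \<open>The term is a function of \<open>n\<close> times a function of \<open>m\<close>, both
  absolutely summable, so it is summable over the whole lattice and hence over any subset.\<close>

lemma cone_term_summable:
  assumes "q \<noteq> 0" "norm q < 1"
  shows "(\<lambda>(n, m). cone_term q n m) summable_on A"
proof -
  have "(\<lambda>j. norm ((-1) powi j * q powi (j\<^sup>2))) summable_on UNIV"
    using powi_square_abs_summable[OF assms(2)] by (simp add: norm_mult norm_power_int)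
  from summable_on_times[OF powi_square_abs_summable[OF assms(2), of UNIV] this]
  have "(\<lambda>(n, m). cone_term q n m) summable_on UNIV \<times> UNIV"
    using assms(1) by (simp add: cone_term_def power_int_add mult_ac)
  then show ?thesis
    by (rule summable_on_subset_banach) auto
qed

text \<open>The reflection \<open>(r, s)\<close> to \<open>(- 1 - r, - 1 - s)\<close> swaps the
  quadrants. It negates both r + s + 1 and r - s, hence fixes each term.\<close>

lemma f_double_sum_q4_eq_0:
  assumes "q \<noteq> 0"
  shows "f_double_sum 1 0 1 (q ^ 4) (q ^ 4) (q ^ 4) = 0"
proof -
  let ?t = "double_sum_term 1 0 1 (q ^ 4) (q ^ 4) (q ^ 4)"
  have "q * ?t (- 1 - r, - 1 - s) = q * ?t (r, s)" for r s
    unfolding double_sum_term_eq_cone_term[OF assms]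
    using cone_term_minus[of q "r + s + 1" "s - r"] cone_term_minus'[of q "r + s + 1" "r - s"]
    by (simp add: algebra_simps)
  then have "?t (- 1 - r, - 1 - s) = ?t (r, s)" for r s
    using assms by simp
  moreover have "bij_betw (\<lambda>(r, s). (- 1 - r, - 1 - s)) ({..<0} \<times> {..<0}) ({0::int..} \<times> {0::int..})"
    by (rule bij_betwI[of _ _ _ "\<lambda>(r, s). (- 1 - r, - 1 - s)"]) auto
  ultimately have "infsum ?t ({..<0} \<times> {..<0}) = infsum ?t ({0..} \<times> {0..})"
    using infsum_reindex_bij_betw[of "\<lambda>(r, s). (- 1 - r, - 1 - s)" _ _ ?t] by (simp add: case_prod_unfold)
  then show ?thesis by (simp add: f_double_sum_def)
qed

text \<open>The difference of the two quadrants is \<open>A\<^sup>2 - B\<^sup>2 = (A - B) * (A + B)\<close>, where \<open>A\<close> and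
  \<open>B\<close> are the two halves of the theta series, and \<open>A - B = 1\<close> is the term at \<open>0\<close>.\<close>

lemma f_double_sum_q2_eq_jtheta:
  assumes "q \<noteq> 0" "norm q < 1"
  shows "f_double_sum 1 0 1 (q\<^sup>2) (q\<^sup>2) (q ^ 4) = jtheta (q\<^sup>2) (q ^ 4)"
proof -
  define th where "th j = (-1) powi j * (q\<^sup>2) powi (j\<^sup>2)" for j
  have q2: "q\<^sup>2 \<noteq> 0" "norm (q\<^sup>2) < 1"
    using assms by (auto simp: norm_power power_less_one_iff)
  have abs: "(\<lambda>j. norm (th j)) summable_on A" for A
    using powi_square_abs_summable[OF q2(2)] by (simp add: th_def norm_mult norm_power_int)
  then have th: "th summable_on A" for A
    by (rule abs_summable_summable)
  have th_minus: "th (- j) = th j" for j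
    by (simp add: th_def power_int_minus flip: power_int_inverse)
  have "double_sum_term 1 0 1 (q\<^sup>2) (q\<^sup>2) (q ^ 4) = (\<lambda>(r, s). th r * th s)"
    using double_sum_term_b0[OF assms(1), of 2] assms(1)
    by (auto simp: fun_eq_iff th_def power_int_add power_int_mult)
  then have f: "f_double_sum 1 0 1 (q\<^sup>2) (q\<^sup>2) (q ^ 4) = (infsum th {0..})\<^sup>2 - (infsum th {..<0})\<^sup>2"
    by (simp add: f_double_sum_def infsum_times abs power2_eq_square)
  have "{0::int..} = {0} \<union> {0<..}" by auto
  then have "infsum th {0..} = infsum th {0} + infsum th {0<..}"
    using infsum_Un_disjoint[OF th th, of "{0}" "{0<..}"] by simp
  moreover have "bij_betw uminus {0<..} {..<0::int}"
    by (rule bij_betwI[of _ _ _ uminus]) auto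
  then have "infsum th {..<0} = infsum th {0<..}"
    using infsum_reindex_bij_betw[of uminus "{0<..}" "{..<0}" th] th_minus by simp
  ultimately have diff: "infsum th {0..} = 1 + infsum th {..<0}"
    by (simp add: th_def)
  have "UNIV = {0::int..} \<union> {..<0}" by auto
  then have "infsum th UNIV = infsum th {0..} + infsum th {..<0}"
    using infsum_Un_disjoint[OF th th, of "{0..}" "{..<0}"] by force
  then have "f_double_sum 1 0 1 (q\<^sup>2) (q\<^sup>2) (q ^ 4) = infsum th UNIV"
    unfolding f diff by (simp add: power2_eq_square algebra_simps)
  \<comment> \<open>The product formula is used with \<open>q\<^sup>2\<close> in place of
    \<open>q\<close>, which makes the base \<open>q ^ 4\<close>.\<close>
  also have "\<dots> = jtheta (q\<^sup>2) (q ^ 4)"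
    using jtheta_eq_alternating_sum[OF q2] by (simp add: th_def[abs_def])
  finally show ?thesis .
qed

section \<open>The cone and its parity classes\<close>

definition lattice_cone :: "(int \<times> int) set" where
  "lattice_cone = (SIGMA n:{0..}. {- n..n})"

definition even_cone :: "(int \<times> int) set" where
  "even_cone = {(n, m) \<in> lattice_cone. even (n + m)}"

definition odd_cone :: "(int \<times> int) set" where
  "odd_cone = {(n, m) \<in> lattice_cone. odd (n + m)}"

text \<open>Nonnegative \<open>r\<close>, \<open>s\<close> satisfy |r - s| \<le> r + s, and even
  parity makes the halves in the inverse exact. The shift by 2 in the second map arises because
  negative \<open>r\<close> and \<open>s\<close> are at most -1.\<close>

lemma bij_betw_even_cone:
  shows "bij_betw (\<lambda>(r, s). (r + s, r - s)) ({0..} \<times> {0..}) even_cone"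
    and "bij_betw (\<lambda>(r, s). (- (r + s) - 2, r - s)) ({..<0} \<times> {..<0}) even_cone"
proof -
  show "bij_betw (\<lambda>(r, s). (r + s, r - s)) ({0..} \<times> {0..}) even_cone"
    by (rule bij_betwI[of _ _ _ "\<lambda>(n, m). ((n + m) div 2, (n - m) div 2)"])
       (auto simp: even_cone_def lattice_cone_def, presburger+)
  show "bij_betw (\<lambda>(r, s). (- (r + s) - 2, r - s)) ({..<0} \<times> {..<0}) even_cone"
    by (rule bij_betwI[of _ _ _ "\<lambda>(n, m). ((m - n) div 2 - 1, (- n - m) div 2 - 1)"])
       (auto simp: even_cone_def lattice_cone_def, presburger+)
qed

text \<open>Odd parity excludes n = |m|, so the odd points are the even ones with \<open>n\<close>
  raised by 1; both maps are the earlier ones plus this shift.\<close>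

lemma bij_betw_odd_cone:
  shows "bij_betw (\<lambda>(r, s). (r + s + 1, r - s)) ({0..} \<times> {0..}) odd_cone"
    and "bij_betw (\<lambda>(r, s). (- (r + s) - 1, r - s)) ({..<0} \<times> {..<0}) odd_cone"
proof -
  show "bij_betw (\<lambda>(r, s). (r + s + 1, r - s)) ({0..} \<times> {0..}) odd_cone"
    by (rule bij_betwI[of _ _ _ "\<lambda>(n, m). ((n + m - 1) div 2, (n - m - 1) div 2)"])
       (auto simp: odd_cone_def lattice_cone_def, presburger+)
  show "bij_betw (\<lambda>(r, s). (- (r + s) - 1, r - s)) ({..<0} \<times> {..<0}) odd_cone"
    by (rule bij_betwI[of _ _ _ "\<lambda>(n, m). ((m - n - 1) div 2, (- n - m - 1) div 2)"])
       (auto simp: odd_cone_def lattice_cone_def, presburger+)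
qed

lemma cone_split: "lattice_cone = even_cone \<union> odd_cone" "even_cone \<inter> odd_cone = {}"
  by (auto simp: even_cone_def odd_cone_def)

text \<open>An unconditional sum may be taken row by row, and each row of the cone is
  finite.\<close>

lemma cone_sums:
  fixes F :: "int \<Rightarrow> int \<Rightarrow> complex"
  assumes "((\<lambda>(n, m). F n m) has_sum S) lattice_cone"
  shows "(\<lambda>n. \<Sum>m = - int n..int n. F (int n) m) sums S"
proof -
  have "((\<lambda>n. \<Sum>m = - n..n. F n m) has_sum S) {0..}"
    by (rule has_sum_SigmaD[OF assms[unfolded lattice_cone_def]]) (auto intro: has_sum_finiteI)
  moreover have "bij_betw int UNIV {0..}"
    by (rule bij_betwI[of _ _ _ nat]) auto
  ultimately have "((\<lambda>n. \<Sum>m = - int n..int n. F (int n) m) has_sum S) UNIV"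
    using has_sum_reindex_bij_betw[of int UNIV "{0..}" "\<lambda>n. \<Sum>m = - n..n. F n m"] by simp
  then show ?thesis by (rule has_sum_imp_sums)
qed

text \<open>The unshifted family collects the nonnegative quadrants and the shifted one the negative
  quadrants. The shift in \<open>n\<close> exchanges the parities: in the second claim
  \<open>U\<close> sits on the even points and \<open>T\<close> on the odd ones.\<close>

lemma double_sums_cone:
  fixes q :: complex
  defines "T \<equiv> double_sum_term 1 0 1 (q\<^sup>2) (q\<^sup>2) (q ^ 4)"
    and "U \<equiv> double_sum_term 1 0 1 (q ^ 4) (q ^ 4) (q ^ 4)"
  assumes "q \<noteq> 0" "norm q < 1"
  shows "((\<lambda>(n, m). cone_term q n m) has_sum
      infsum T ({0..} \<times> {0..}) + q * infsum U ({0..} \<times> {0..})) lattice_cone"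
    and "((\<lambda>(n, m). cone_term q (n + 1) m) has_sum
      infsum T ({..<0} \<times> {..<0}) + q * infsum U ({..<0} \<times> {..<0})) lattice_cone"
proof -
  have T: "T = (\<lambda>(r, s). cone_term q (r + s) (r - s))"
    and U: "(\<lambda>p. q * U p) = (\<lambda>(r, s). cone_term q (r + s + 1) (r - s))"
    unfolding T_def U_def using double_sum_term_eq_cone_term[OF assms(3)] by (auto simp: fun_eq_iff)
  have qU: "q * infsum U A = (\<Sum>\<^sub>\<infinity>(r, s)\<in>A. cone_term q (r + s + 1) (r - s))" for A
    unfolding U[symmetric] by (simp add: infsum_cmult_right')
  have summable: "(\<lambda>(n, m). cone_term q n m) summable_on A" for A
    by (rule cone_term_summable[OF assms(3,4)])
  have bij: "bij_betw (\<lambda>(n, m). (n + 1, m)) A ((\<lambda>(n, m). (n + 1, m)) ` A)" for A :: "(int \<times> int) set"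
    by (auto intro!: inj_onI simp: bij_betw_def)
  have summable_Suc: "(\<lambda>(n, m). cone_term q (n + 1) m) summable_on A" for A
    using iffD2[OF summable_on_reindex_bij_betw[OF bij] summable, of A]
    by (simp add: case_prod_unfold)
  have "infsum (\<lambda>(n, m). cone_term q n m) even_cone = infsum T ({0..} \<times> {0..})"
    using infsum_reindex_bij_betw[OF bij_betw_even_cone(1), of "\<lambda>(n, m). cone_term q n m"]
    by (simp add: T case_prod_unfold)
  moreover have "infsum (\<lambda>(n, m). cone_term q n m) odd_cone = q * infsum U ({0..} \<times> {0..})"
    using infsum_reindex_bij_betw[OF bij_betw_odd_cone(1), of "\<lambda>(n, m). cone_term q n m"]
    by (simp add: qU case_prod_unfold)
  ultimately show "((\<lambda>(n, m). cone_term q n m) has_sum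
      infsum T ({0..} \<times> {0..}) + q * infsum U ({0..} \<times> {0..})) lattice_cone"
    using has_sum_Un_disjoint[OF has_sum_infsum[OF summable] has_sum_infsum[OF summable] cone_split(2)]
    by (simp add: cone_split(1))
  \<comment> \<open>Evenness in \<open>n\<close> absorbs the reflection in the maps from the
    negative quadrant.\<close>
  have flip: "cone_term q (- (r + s) - 1) (r - s) = cone_term q (r + s + 1) (r - s)"
    "cone_term q (- (r + s)) (r - s) = cone_term q (r + s) (r - s)" for r s
    using cone_term_minus[of q "r + s + 1" "r - s"] cone_term_minus[of q "r + s" "r - s"]
    by simp_all
  have "infsum (\<lambda>(n, m). cone_term q (n + 1) m) even_cone = q * infsum U ({..<0} \<times> {..<0})"
    using infsum_reindex_bij_betw[OF bij_betw_even_cone(2), of "\<lambda>(n, m). cone_term q (n + 1) m"] flip(1)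
    by (simp add: qU case_prod_unfold)
  moreover have "infsum (\<lambda>(n, m). cone_term q (n + 1) m) odd_cone = infsum T ({..<0} \<times> {..<0})"
    using infsum_reindex_bij_betw[OF bij_betw_odd_cone(2), of "\<lambda>(n, m). cone_term q (n + 1) m"] flip(2)
    by (simp add: T case_prod_unfold)
  ultimately show "((\<lambda>(n, m). cone_term q (n + 1) m) has_sum
      infsum T ({..<0} \<times> {..<0}) + q * infsum U ({..<0} \<times> {..<0})) lattice_cone"
    using has_sum_Un_disjoint[OF has_sum_infsum[OF summable_Suc] has_sum_infsum[OF summable_Suc] cone_split(2)]
    by (simp add: cone_split(1) add.commute)
qed

section \<open>Assembly of the expansions for g and f\<close>

text \<open>The difference of consecutive squares, 2n + 1, is the source of the factor 1 + q^(2n+1)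
  or 1 - q^(2n+1).\<close>

lemma cone_term_Suc:
  assumes "q \<noteq> 0"
  shows "cone_term q (int n + 1) m = (-1) powi m * q powi (m\<^sup>2 + (int n)\<^sup>2) * q ^ (2 * n + 1)"
proof -
  have "m\<^sup>2 + (int n + 1)\<^sup>2 = m\<^sup>2 + (int n)\<^sup>2 + int (2 * n + 1)"
    by (simp add: power2_eq_square algebra_simps)
  then show ?thesis
    using assms unfolding cone_term_def
    by (metis (no_types, lifting) mult.assoc power_int_add power_int_of_nat)
qed

theorem proposition5p1:
  fixes q :: complex
  assumes "0 < norm q" and "norm q < 1"
  shows "((\<lambda>n::nat. \<Sum>m = - int n..int n.
            (-1) powi m * q powi (m\<^sup>2 + (int n)\<^sup>2) * (1 + q ^ (2 * n + 1)))
          sums (g_double_sum 1 0 1 (q ^ 2) (q ^ 2) (q ^ 4)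
                + q * g_double_sum 1 0 1 (q ^ 4) (q ^ 4) (q ^ 4)))
    \<and> ((\<lambda>n::nat. \<Sum>m = - int n..int n.
            (-1) powi m * q powi (m\<^sup>2 + (int n)\<^sup>2) * (1 - q ^ (2 * n + 1)))
          sums (f_double_sum 1 0 1 (q ^ 2) (q ^ 2) (q ^ 4)
                + q * f_double_sum 1 0 1 (q ^ 4) (q ^ 4) (q ^ 4)))
    \<and> f_double_sum 1 0 1 (q ^ 2) (q ^ 2) (q ^ 4)
           + q * f_double_sum 1 0 1 (q ^ 4) (q ^ 4) (q ^ 4)
         = jtheta (q ^ 2) (q ^ 4)"
proof (intro conjI)
  have q: "q \<noteq> 0" "norm q < 1" using assms by auto
  \<comment> \<open>Adding the two series joins the quadrants with the sign of g; subtracting them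
    gives that of f.\<close>
  note S = cone_sums[OF double_sums_cone(1)[OF q]] cone_sums[OF double_sums_cone(2)[OF q]]
  show "(\<lambda>n::nat. \<Sum>m = - int n..int n.
            (-1) powi m * q powi (m\<^sup>2 + (int n)\<^sup>2) * (1 + q ^ (2 * n + 1)))
          sums (g_double_sum 1 0 1 (q ^ 2) (q ^ 2) (q ^ 4)
                + q * g_double_sum 1 0 1 (q ^ 4) (q ^ 4) (q ^ 4))"
    using sums_add[OF S]
    unfolding g_double_sum_def cone_term_Suc[OF q(1)] unfolding cone_term_def sum.distrib[symmetric]
    by (simp add: algebra_simps)
  show "(\<lambda>n::nat. \<Sum>m = - int n..int n.
            (-1) powi m * q powi (m\<^sup>2 + (int n)\<^sup>2) * (1 - q ^ (2 * n + 1)))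
          sums (f_double_sum 1 0 1 (q ^ 2) (q ^ 2) (q ^ 4)
                + q * f_double_sum 1 0 1 (q ^ 4) (q ^ 4) (q ^ 4))"
    using sums_diff[OF S]
    unfolding f_double_sum_def cone_term_Suc[OF q(1)] unfolding cone_term_def sum_subtractf[symmetric]
    by (simp add: algebra_simps)
  show "f_double_sum 1 0 1 (q ^ 2) (q ^ 2) (q ^ 4)
           + q * f_double_sum 1 0 1 (q ^ 4) (q ^ 4) (q ^ 4)
         = jtheta (q ^ 2) (q ^ 4)"
    using f_double_sum_q2_eq_jtheta[OF q] f_double_sum_q4_eq_0[OF q(1)] by simp
qed

end
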